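(* Let $\mathbb{F}=\mathbb{R}$ or $\mathbb{C}$, let $n \geq 1$, let $R \subseteq \mathbb{F}^n\times \mathbb{F}^n$, and let $E$ and $F$ be linear subspaces of $\mathbb{F}^n$. Then the coherent path capacity $CPC_R(E,F)$ between $E$ and $F$ relative to $R$ equals the minimum size of an $(E,F)$-separator relative to $R$.
   Context: Orthogonality is with respect to the standard inner product on $\mathbb{F}^n$; $wv^*$ is the linear map $u \mapsto \langle u,v\rangle w$; and $\mathcal{V}_R = \mathrm{span}\{wv^* : (v,w)\in R\} \subseteq M_n(\mathbb{F})$. Coherent path capacity: let $\iota: E \to \mathbb{F}^n$ be the natural inclusion and $\pi: \mathbb{F}^n \to F$ the orthogonal projection. Then $CPC_R(E,F)$ is the maximum value of $$\mathrm{rank}\begin{bmatrix} I - A & \iota\\ \pi & 0\end{bmatrix} - n$$ over all $A \in \mathcal{V}_R$, where the block matrix represents a linear map from $\mathbb{F}^n \oplus E$ to $\mathbb{F}^n \oplus F$. An $(E,F)$-separator relative to $R$ is a pair $(\tilde E,\tilde F)$ of linear subspaces of $\mathbb{F}^n$ such that (1) $E \subseteq \tilde E$ and $F \subseteq \tilde F$; (2) $\tilde F^\perp \subseteq \tilde E$; (3) for every $(v,w) \in R$, either $v \in \tilde F$ or $w \in \tilde E$. Its size is $\dim(\tilde E \cap \tilde F)$. *)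

theory Defs
  imports
    "HOL-Analysis.Analysis"
    "Jordan_Normal_Form.Conjugate"
begin

text \<open>
  The scalar field is a type of class \<^class>\<open>conjugatable_field\<close>, so that one set of definitions
  covers the reals (where \<^const>\<open>conjugate\<close> is the identity) and the complex numbers (where it is
  complex conjugation). The space of column vectors is \<open>'a ^ 'n\<close> with \<open>n = CARD('n)\<close>, and
  subspaces, spans and dimensions are always taken over the scalar field \<open>'a\<close>.
\<close>

definition std_inner :: "'a::conjugatable_field ^ 'n \<Rightarrow> 'a ^ 'n \<Rightarrow> 'a" where
  "std_inner u v = (\<Sum>i\<in>UNIV. u $ i * conjugate (v $ i))"

definition orth_compl :: "('a::conjugatable_field ^ 'n) set \<Rightarrow> ('a ^ 'n) set" where
  "orth_compl S = {u. \<forall>v\<in>S. std_inner u v = 0}"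

definition orth_proj :: "('a::conjugatable_field ^ 'n) set \<Rightarrow> 'a ^ 'n \<Rightarrow> 'a ^ 'n" where
  "orth_proj F u = (THE p. p \<in> F \<and> u - p \<in> orth_compl F)"

text \<open>The matrix \<open>w v\<^sup>*\<close> of the linear map sending \<open>u\<close> to \<open>\<langle>u, v\<rangle> w\<close>; see \<open>outer_mult_vec\<close> below.\<close>

definition outer :: "'a::conjugatable_field ^ 'n \<Rightarrow> 'a ^ 'n \<Rightarrow> 'a ^ 'n ^ 'n" where
  "outer w v = (\<chi> i j. w $ i * conjugate (v $ j))"

lemma outer_mult_vec: "outer w v *v u = std_inner u v *s w"
  by (simp add: outer_def std_inner_def matrix_vector_mult_def vec_eq_iff
      sum_distrib_left sum_distrib_right mult_ac)

definition mat_scale :: "'a::field \<Rightarrow> 'a ^ 'n ^ 'n \<Rightarrow> 'a ^ 'n ^ 'n" where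
  "mat_scale c A = (\<chi> i j. c * A $ i $ j)"

interpretation mat: vector_space mat_scale
  by unfold_locales (simp_all add: mat_scale_def vec_eq_iff algebra_simps)

definition rel_space ::
  "(('a::conjugatable_field ^ 'n) \<times> ('a ^ 'n)) set \<Rightarrow> ('a ^ 'n ^ 'n) set" where
  "rel_space R = mat.span {outer w v |v w. (v, w) \<in> R}"

text \<open>
  The external direct sum of two copies of \<open>'a ^ 'n\<close> is the product type with componentwise
  scaling. The block map is defined on all of this type; its domain \<open>'a ^ 'n \<oplus> E\<close> is the subset
  \<open>UNIV \<times> E\<close>, and its rank is the dimension of the image of that subset.
\<close>

interpretation pair: finite_dimensional_vector_space_prod
  "(*s) :: 'a::field \<Rightarrow> 'a ^ 'n \<Rightarrow> 'a ^ 'n" "(*s) :: 'a \<Rightarrow> 'a ^ 'n \<Rightarrow> 'a ^ 'n"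
  cart_basis cart_basis ..

definition block_map ::
  "('a::conjugatable_field ^ 'n) set \<Rightarrow> 'a ^ 'n ^ 'n \<Rightarrow> ('a ^ 'n) \<times> ('a ^ 'n) \<Rightarrow> ('a ^ 'n) \<times> ('a ^ 'n)"
  where "block_map F A = (\<lambda>(u, e). ((mat 1 - A) *v u + e, orth_proj F u))"

definition block_rank ::
  "('a::conjugatable_field ^ 'n) set \<Rightarrow> ('a ^ 'n) set \<Rightarrow> 'a ^ 'n ^ 'n \<Rightarrow> nat" where
  "block_rank E F A = pair.p.dim (block_map F A ` (UNIV \<times> E))"

text \<open>
  Integer-valued, since for a particular \<open>A\<close> the rank can be less than \<open>n\<close>.
\<close>

definition coherent_path_capacity ::
  "(('a::conjugatable_field ^ 'n) \<times> ('a ^ 'n)) set \<Rightarrow> ('a ^ 'n) set \<Rightarrow> ('a ^ 'n) set \<Rightarrow> int" where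
  "coherent_path_capacity R E F =
     Max {int (block_rank E F A) - int CARD('n) |A. A \<in> rel_space R}"

definition is_separator ::
  "(('a::conjugatable_field ^ 'n) \<times> ('a ^ 'n)) set \<Rightarrow> ('a ^ 'n) set \<Rightarrow> ('a ^ 'n) set \<Rightarrow>
   ('a ^ 'n) set \<Rightarrow> ('a ^ 'n) set \<Rightarrow> bool" where
  "is_separator R E F E' F' \<longleftrightarrow>
     vec.subspace E' \<and> vec.subspace F' \<and>
     E \<subseteq> E' \<and> F \<subseteq> F' \<and>
     orth_compl F' \<subseteq> E' \<and>
     (\<forall>(v, w)\<in>R. v \<in> F' \<or> w \<in> E')"

definition min_separator_size ::
  "(('a::conjugatable_field ^ 'n) \<times> ('a ^ 'n)) set \<Rightarrow> ('a ^ 'n) set \<Rightarrow> ('a ^ 'n) set \<Rightarrow> nat" where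
  "min_separator_size R E F = Min {vec.dim (E' \<inter> F') |E' F'. is_separator R E F E' F'}"

text \<open>The sets under \<^const>\<open>Max\<close> and \<^const>\<open>Min\<close> are finite and nonempty, so both are attained.\<close>

lemma capacity_set_finite_nonempty:
  fixes R :: "(('a::conjugatable_field ^ 'n) \<times> ('a ^ 'n)) set"
    and E F :: "('a ^ 'n) set"
  defines "S \<equiv> {int (block_rank E F A) - int CARD('n) |A. A \<in> rel_space R}"
  shows "finite S" "S \<noteq> {}"
proof -
  have "block_rank E F A \<le> pair.p.dim (UNIV :: (('a ^ 'n) \<times> ('a ^ 'n)) set)" for A
    unfolding block_rank_def by (rule pair.p.dim_subset) simp
  then have "S \<subseteq> {- int CARD('n) .. int (pair.p.dim (UNIV :: (('a ^ 'n) \<times> ('a ^ 'n)) set)) - int CARD('n)}"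
    unfolding S_def by auto
  then show "finite S" by (rule finite_subset) simp
  show "S \<noteq> {}"
    unfolding S_def rel_space_def using mat.span_zero by blast
qed

lemma separator_set_finite_nonempty:
  fixes R :: "(('a::conjugatable_field ^ 'n) \<times> ('a ^ 'n)) set"
    and E F :: "('a ^ 'n) set"
  defines "S \<equiv> {vec.dim (E' \<inter> F') |E' F'. is_separator R E F E' F'}"
  shows "finite S" "S \<noteq> {}"
proof -
  have "vec.dim (X :: ('a ^ 'n) set) \<le> vec.dim (UNIV :: ('a ^ 'n) set)" for X
    by (rule vec.dim_subset) simp
  then have "S \<subseteq> {.. vec.dim (UNIV :: ('a ^ 'n) set)}"
    unfolding S_def by auto
  then show "finite S" by (rule finite_subset) simp
  have "is_separator R E F UNIV UNIV"
    by (auto simp: is_separator_def vec.subspace_UNIV)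
  then show "S \<noteq> {}" unfolding S_def by blast
qed

end

theory Submission
  imports Defs
begin

text \<open>
  Let \<open>A\<close> give the block map \<open>f\<close> its maximal rank. If \<open>(v, w) \<in> R\<close> and the functional
  \<open>\<langle>_, v\<rangle>\<close> does not vanish on the kernel of \<open>f\<close>, then \<open>(w, 0)\<close> lies in the image of \<open>f\<close>, as
  otherwise adding \<open>w v\<^sup>*\<close> to \<open>A\<close> would raise the rank; hence this addition preserves the image while
  it moves the kernel. Let \<open>K\<close> be the span of the kernels of all maps reachable from \<open>f\<close> by such
  moves. Then the moves also preserve \<open>f ` K\<close>, and for each \<open>(v, w) \<in> R\<close> either \<open>v\<close> is orthogonal
  to \<open>K\<close> or \<open>(w, 0) \<in> f ` K\<close>. With \<open>W = {w. (w, 0) \<in> f ` K}\<close> and with \<open>N\<close> the part of the first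
  projection of \<open>K\<close> that is orthogonal to \<open>F\<close>, the pair \<open>(W + E, N\<^sup>\<bottom>)\<close> is a separator, and
  rank-nullity bounds its size by the rank of \<open>f\<close> minus \<open>n\<close>. Conversely, for every separator
  \<open>(E', F')\<close> and every \<open>A\<close> the block map sends \<open>F'\<^sup>\<bottom> \<oplus> E\<close> into \<open>E' \<oplus> 0\<close>, which bounds its rank.
\<close>

section \<open>Rank-nullity on subspaces, and rank-one perturbations of maps of maximal rank\<close>

context finite_dimensional_vector_space_pair
begin

text \<open>A linear right inverse \<open>g\<close> of \<open>f\<close>, defined on the image of
  \<open>S\<close> and taking values in \<open>S\<close>, embeds that image as a complement of the
  kernel in \<open>S\<close>.\<close>

lemma dim_image_kernel:
  assumes f: "Vector_Spaces.linear s1 s2 f" and S: "vs1.subspace S"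
  shows "vs1.dim {x \<in> S. f x = 0} + vs2.dim (f ` S) = vs1.dim S"
proof -
  interpret f: Vector_Spaces.linear s1 s2 f by fact
  interpret swap: finite_dimensional_vector_space_pair s2 B2 s1 B1 ..
  obtain g where g: "range g \<subseteq> S" "Vector_Spaces.linear s2 s1 g" "\<And>v. v \<in> f ` S \<Longrightarrow> f (g v) = v"
    using linear_exists_right_inverse_on[OF f S] by blast
  interpret g: Vector_Spaces.linear s2 s1 g by fact
  have ker: "vs1.subspace {x \<in> S. f x = 0}"
    using S by (auto simp: vs1.subspace_def f.zero f.add f.scale)
  have fS: "vs2.subspace (f ` S)"
    using S by (rule f.subspace_image)
  have comp: "vs1.subspace (g ` f ` S)"
    using fS by (rule g.subspace_image)
  have "{x + y |x y. x \<in> {x \<in> S. f x = 0} \<and> y \<in> g ` f ` S} = S"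
  proof (intro equalityI subsetI)
    fix x assume "x \<in> {x + y |x y. x \<in> {x \<in> S. f x = 0} \<and> y \<in> g ` f ` S}"
    then show "x \<in> S" using g(1) vs1.subspace_add[OF S] by auto
  next
    fix x assume x: "x \<in> S"
    have "x - g (f x) \<in> S" using x g(1) vs1.subspace_diff[OF S] by blast
    moreover have "f (x - g (f x)) = 0" using g(3) x by (simp add: f.diff)
    ultimately have "x - g (f x) \<in> {x \<in> S. f x = 0}" "x = (x - g (f x)) + g (f x)" by auto
    with x show "x \<in> {x + y |x y. x \<in> {x \<in> S. f x = 0} \<and> y \<in> g ` f ` S}" by blast
  qed
  moreover have "{x \<in> S. f x = 0} \<inter> g ` f ` S \<subseteq> {0}"
    using g(3) by (auto simp: g.zero)
  then have "vs1.dim ({x \<in> S. f x = 0} \<inter> g ` f ` S) = 0"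
    by (simp add: vs1.dim_eq_0)
  moreover have "vs1.dim (g ` f ` S) = vs2.dim (f ` S)"
  proof (rule swap.dim_image_eq[OF g(2)])
    show "inj_on g (vs2.span (f ` S))"
      using g(3) vs2.span_eq_iff[THEN iffD2, OF fS] by (metis inj_on_inverseI)
  qed
  ultimately show ?thesis
    using vs1.dim_sums_Int[OF ker comp] by (simp only: add_0_right)
qed

text \<open>A pair in \<open>G\<close> encodes the rank-one map sending \<open>x\<close> to
  \<open>\<phi> x\<close> times \<open>w\<close>. That \<open>K\<close> contains the whole kernel of
  \<open>f\<close> on \<open>D\<close> matters for counting: restricting \<open>f\<close> from
  \<open>D\<close> to \<open>K\<close> then lowers the rank by exactly the drop in
  dimension.\<close>

lemma max_rank_obstruction:
  fixes P :: "('b \<Rightarrow> 'c) set" and G :: "(('b \<Rightarrow> 'a) \<times> 'c) set"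
  assumes lin: "\<And>g. g \<in> P \<Longrightarrow> Vector_Spaces.linear s1 s2 g"
    and functional: "\<And>\<phi> w. (\<phi>, w) \<in> G \<Longrightarrow> Vector_Spaces.linear s1 (*) \<phi>"
    and closed: "\<And>g \<phi> w. g \<in> P \<Longrightarrow> (\<phi>, w) \<in> G \<Longrightarrow> (\<lambda>x. g x + s2 (\<phi> x) w) \<in> P"
    and D: "vs1.subspace D"
    and f: "f \<in> P"
    and max: "\<And>g. g \<in> P \<Longrightarrow> vs2.dim (g ` D) \<le> vs2.dim (f ` D)"
  obtains K where "vs1.subspace K" "K \<subseteq> D" "{x \<in> D. f x = 0} \<subseteq> K"
    "\<And>\<phi> w. (\<phi>, w) \<in> G \<Longrightarrow> (\<forall>x\<in>K. \<phi> x = 0) \<or> w \<in> f ` K"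
proof -
  define step where "step = {(g, h). \<exists>\<phi> w z. (\<phi>, w) \<in> G \<and> z \<in> D \<and> g z = 0 \<and> \<phi> z \<noteq> 0 \<and>
    h = (\<lambda>x. g x + s2 (\<phi> x) w)}"
  define Q where "Q = step\<^sup>* `` {f}"
  define K where "K = vs1.span (\<Union>g\<in>Q. {x \<in> D. g x = 0})"
  have K: "vs1.subspace K" unfolding K_def by simp
  have ker_K: "x \<in> K" if "g \<in> Q" "x \<in> D" "g x = 0" for g x
    unfolding K_def using that by (intro vs1.span_base) blast
  have "K \<subseteq> D"
    unfolding K_def by (rule vs1.span_minimal[OF _ D]) blast
  have phi: "\<phi> (x + y) = \<phi> x + \<phi> y" "\<phi> (s1 c x) = c * \<phi> x" "\<phi> (x - y) = \<phi> x - \<phi> y"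
    if "(\<phi>, w) \<in> G" for \<phi> w x y c
  proof -
    interpret Vector_Spaces.linear s1 "(*)" \<phi> using functional[OF that] .
    show "\<phi> (x + y) = \<phi> x + \<phi> y" "\<phi> (s1 c x) = c * \<phi> x" "\<phi> (x - y) = \<phi> x - \<phi> y"
      by (rule add scale diff)+
  qed

  \<comment> \<open>Replacing \<open>x\<close> by a translate \<open>x - c z\<close> on which \<open>\<phi>\<close> vanishes shows that the image
    of \<open>g\<close> survives the perturbation.\<close>
  have image_subset: "g ` S \<subseteq> (\<lambda>x. g x + s2 (\<phi> x) w) ` S"
    if "g \<in> P" "(\<phi>, w) \<in> G" "vs1.subspace S" "z \<in> S" "g z = 0" "\<phi> z \<noteq> 0" for g \<phi> w z S
  proof
    fix v assume "v \<in> g ` S"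
    then obtain x where x: "x \<in> S" "v = g x" by blast
    let ?y = "x - s1 (\<phi> x / \<phi> z) z"
    interpret g: Vector_Spaces.linear s1 s2 g using lin[OF that(1)] .
    have "\<phi> ?y = 0" "g ?y = v"
      using that x by (simp_all add: phi[OF that(2)] g.diff g.scale)
    moreover have "?y \<in> S"
      using that x by (simp add: vs1.subspace_diff vs1.subspace_scale)
    ultimately show "v \<in> (\<lambda>x. g x + s2 (\<phi> x) w) ` S"
      by (intro image_eqI[of _ _ ?y]) simp_all
  qed
  have subset_image: "(\<lambda>x. g x + s2 (\<phi> x) w) ` S \<subseteq> g ` S"
    if "g \<in> P" "vs1.subspace S" "w \<in> g ` S" for g S and \<phi> :: "'b \<Rightarrow> 'a" and w
  proof
    interpret g: Vector_Spaces.linear s1 s2 g using lin[OF that(1)] .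
    fix v assume "v \<in> (\<lambda>x. g x + s2 (\<phi> x) w) ` S"
    then obtain x where "x \<in> S" "v = g x + s2 (\<phi> x) w" by blast
    then show "v \<in> g ` S"
      using g.subspace_image[OF that(2)] that(3)
      by (auto intro!: vs2.subspace_add vs2.subspace_scale)
  qed

  have w_image: "w \<in> g ` D"
    if "g \<in> P" "g ` D = f ` D" "(\<phi>, w) \<in> G" "z \<in> D" "g z = 0" "\<phi> z \<noteq> 0" for g \<phi> w z
  proof (rule ccontr)
    assume w: "w \<notin> g ` D"
    interpret g: Vector_Spaces.linear s1 s2 g using lin[OF that(1)] .
    let ?h = "\<lambda>x. g x + s2 (\<phi> x) w"
    have h: "?h \<in> P" using closed that by blast
    interpret h: Vector_Spaces.linear s1 s2 ?h using lin[OF h] .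
    have gD: "vs2.subspace (g ` D)" using D by (rule g.subspace_image)
    \<comment> \<open>Since \<open>g z = 0\<close>, the new map sends \<open>z\<close> to
      \<open>\<phi> z\<close> times \<open>w\<close>. So its image contains \<open>w\<close> besides
      the old image, and the rank would exceed the maximum.\<close>
    have "w = ?h (s1 (1 / \<phi> z) z)"
      using that by (simp add: phi[OF that(3)] g.scale)
    then have "w \<in> ?h ` D"
      using that(4) D vs1.subspace_scale by blast
    then have "insert w (g ` D) \<subseteq> ?h ` D"
      using image_subset[OF that(1,3) D that(4,5,6)] by blast
    then have "vs2.dim (insert w (g ` D)) \<le> vs2.dim (?h ` D)"
      by (rule vs2.dim_subset)
    moreover have "vs2.dim (insert w (g ` D)) = vs2.dim (g ` D) + 1"
      using w by (simp add: vs2.dim_insert vs2.span_eq_iff[THEN iffD2, OF gD])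
    ultimately show False using max[OF h] that(2) by simp
  qed

  \<comment> \<open>A preimage of \<open>w\<close> in \<open>D\<close> is corrected by a multiple of
    \<open>z\<close> until it lies in the kernel of the next map \<open>?h\<close>. That kernel is
    among the generators of \<open>K\<close> because \<open>K\<close> uses all reachable
    maps.\<close>
  have w_K: "w \<in> g ` K"
    if g: "g \<in> Q" "g \<in> P" "g ` D = f ` D"
      and z: "(\<phi>, w) \<in> G" "z \<in> D" "g z = 0" "\<phi> z \<noteq> 0" for g \<phi> w z
  proof -
    interpret g: Vector_Spaces.linear s1 s2 g using lin[OF g(2)] .
    let ?h = "\<lambda>x. g x + s2 (\<phi> x) w"
    have "(g, ?h) \<in> step" unfolding step_def using z by blast
    then have h: "?h \<in> Q" using g(1) unfolding Q_def by (auto intro: rtrancl_into_rtrancl)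
    obtain y where y: "y \<in> D" "w = g y" using w_image[OF g(2,3) z] by blast
    \<comment> \<open>The scalar is chosen to make \<open>\<phi>\<close> equal to \<open>-1\<close>, so that \<open>?u\<close> is in the kernel of \<open>?h\<close>.\<close>
    let ?s = "(- 1 - \<phi> y) / \<phi> z" let ?u = "y + s1 ?s z"
    have "\<phi> ?u = - 1" "g ?u = w"
      using z y by (simp_all add: phi[OF z(1)] g.add g.scale)
    then have "?h ?u = 0" by simp
    moreover have "?u \<in> D" using y z(2) D by (simp add: vs1.subspace_add vs1.subspace_scale)
    ultimately have "?u \<in> K" using ker_K[OF h] by blast
    with \<open>g ?u = w\<close> show ?thesis by blast
  qed

  \<comment> \<open>As \<open>K\<close> is fixed beforehand, it contains each kernel vector met on
    the way; with \<open>w_K\<close> this keeps the image of \<open>K\<close> constant, not only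
    that of \<open>D\<close>.\<close>
  have inv: "g \<in> P \<and> g ` D = f ` D \<and> g ` K = f ` K" if "g \<in> Q" for g
  proof -
    have "(f, g) \<in> step\<^sup>*" using that by (simp add: Q_def)
    then show ?thesis
    proof (induction rule: rtrancl_induct)
      case base
      then show ?case using f by simp
    next
      case (step g h)
      then have g: "g \<in> Q" by (simp add: Q_def)
      from step obtain \<phi> w z where z: "(\<phi>, w) \<in> G" "z \<in> D" "g z = 0" "\<phi> z \<noteq> 0"
        and h: "h = (\<lambda>x. g x + s2 (\<phi> x) w)"
        by (auto simp: step_def)
      have gP: "g \<in> P" "g ` D = f ` D" "g ` K = f ` K" using step.IH by auto
      have "z \<in> K" using ker_K g z by blast
      have "h ` D = g ` D"
        unfolding h using image_subset[OF gP(1) z(1) D z(2,3,4)]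
          subset_image[OF gP(1) D w_image[OF gP(1,2) z], of \<phi>] by blast
      moreover have "h ` K = g ` K"
        unfolding h using image_subset[OF gP(1) z(1) K \<open>z \<in> K\<close> z(3,4)]
          subset_image[OF gP(1) K w_K[OF g gP(1,2) z], of \<phi>] by blast
      ultimately show ?case using closed[OF gP(1) z(1)] gP h by simp
    qed
  qed

  \<comment> \<open>Either \<open>\<phi>\<close> vanishes on all generators of \<open>K\<close>, or
    \<open>w_K\<close> applies to some reachable \<open>g\<close> and \<open>inv\<close> carries the
    result back to \<open>f\<close>.\<close>
  have "(\<forall>x\<in>K. \<phi> x = 0) \<or> w \<in> f ` K" if G: "(\<phi>, w) \<in> G" for \<phi> w
  proof (cases "\<exists>g\<in>Q. \<exists>z\<in>D. g z = 0 \<and> \<phi> z \<noteq> 0")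
    case True
    then obtain g z where "g \<in> Q" "z \<in> D" "g z = 0" "\<phi> z \<noteq> 0" by blast
    then show ?thesis using w_K[of g \<phi> w z] inv[of g] G by auto
  next
    case False
    interpret \<phi>: Vector_Spaces.linear s1 "(*)" \<phi> using functional[OF G] .
    have "K \<subseteq> {x. \<phi> x = 0}"
      unfolding K_def using False by (intro vs1.span_minimal \<phi>.subspace_kernel) blast
    then show ?thesis by blast
  qed
  moreover have "{x \<in> D. f x = 0} \<subseteq> K"
    using ker_K[of f] by (auto simp: Q_def)
  ultimately show thesis using that K \<open>K \<subseteq> D\<close> by blast
qed

end

section \<open>The standard inner product, orthogonal complements and projections\<close>

lemma std_inner_linear: "Vector_Spaces.linear (*s) (*) (\<lambda>u. std_inner u v)"
  by (simp add: Vector_Spaces.linear_iff vec.vector_space_axioms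
      vector_space_over_itself.vector_space_axioms std_inner_def sum.distrib distrib_right
      sum_distrib_left mult.assoc)

lemma std_inner_left [simp]:
  "std_inner (u + u') v = std_inner u v + std_inner u' v"
  "std_inner (u - u') v = std_inner u v - std_inner u' v"
  "std_inner (c *s u) v = c * std_inner u v"
  "std_inner 0 v = 0"
proof -
  interpret Vector_Spaces.linear "(*s)" "(*)" "\<lambda>u. std_inner u v"
    by (rule std_inner_linear)
  show "std_inner (u + u') v = std_inner u v + std_inner u' v"
    "std_inner (u - u') v = std_inner u v - std_inner u' v"
    "std_inner (c *s u) v = c * std_inner u v" "std_inner 0 v = 0"
    by (rule add diff scale zero)+
qed

lemma conjugate_std_inner: "conjugate (std_inner u v) = std_inner v u"
  by (simp add: std_inner_def sum_conjugate conjugate_dist_mul mult.commute)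

lemma std_inner_eq_0_commute: "std_inner u v = 0 \<longleftrightarrow> std_inner v u = 0"
  by (metis conjugate_std_inner conjugate_zero_iff)

lemma std_inner_0_right [simp]: "std_inner u 0 = 0"
  by (simp add: std_inner_def)

text \<open>Definiteness comes from the order on the field: all summands are nonnegative, so a zero
  sum makes each of them zero.\<close>

lemma std_inner_self_eq_0 [simp]:
  fixes u :: "'a::conjugatable_ordered_field ^ 'n"
  shows "std_inner u u = 0 \<longleftrightarrow> u = 0"
proof
  assume "std_inner u u = 0"
  then have "\<forall>i. u $ i * conjugate (u $ i) = 0"
    unfolding std_inner_def
    by (subst (asm) sum_nonneg_eq_0_iff) (auto simp: conjugate_square_positive)
  then show "u = 0" by (simp add: vec_eq_iff)
qed simp

lemma subspace_orth_compl: "vec.subspace (orth_compl S)"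
  by (auto simp: vec.subspace_def orth_compl_def)

text \<open>Orthogonality is symmetric, so the vectors to which \<open>u\<close> is orthogonal form
  the subspace \<open>orth_compl {u}\<close>; it contains the span of \<open>B\<close> once it
  contains \<open>B\<close>.\<close>

lemma orth_compl_span: "orth_compl (vec.span B) = orth_compl B"
proof
  show "orth_compl (vec.span B) \<subseteq> orth_compl B"
    by (auto simp: orth_compl_def vec.span_base)
  show "orth_compl B \<subseteq> orth_compl (vec.span B)"
  proof
    fix u assume u: "u \<in> orth_compl B"
    have "vec.span B \<subseteq> orth_compl {u}"
      using u by (intro vec.span_minimal subspace_orth_compl)
        (auto simp: orth_compl_def std_inner_eq_0_commute)
    then show "u \<in> orth_compl (vec.span B)"
      by (auto simp: orth_compl_def std_inner_eq_0_commute)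
  qed
qed

text \<open>The induction is the Gram--Schmidt process.\<close>

lemma orth_decomposition_span:
  fixes u :: "'a::conjugatable_ordered_field ^ 'n"
  assumes "finite B"
  shows "\<exists>p\<in>vec.span B. u - p \<in> orth_compl B"
  using assms
proof (induction B arbitrary: u rule: finite_induct)
  case empty
  then show ?case by (auto simp: orth_compl_def)
next
  case (insert b B)
  obtain p where p: "p \<in> vec.span B" "b - p \<in> orth_compl B" using insert.IH by blast
  obtain r where r: "r \<in> vec.span B" "u - r \<in> orth_compl B" using insert.IH by blast
  define q where "q = b - p"
  \<comment> \<open>\<open>q\<close> is the component of \<open>b\<close> orthogonal to
    \<open>B\<close>; \<open>s\<close> adds to \<open>r\<close> the projection of
    \<open>u - r\<close> onto \<open>q\<close>. If \<open>b\<close> is already in the span of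
    \<open>B\<close>, then \<open>q = 0\<close> and nothing is added.\<close>
  define s where "s = r + (std_inner (u - r) q / std_inner q q) *s q"
  have us: "u - s = (u - r) - (std_inner (u - r) q / std_inner q q) *s q"
    by (simp add: s_def)
  have q: "std_inner (u - s) q = 0"
    unfolding us std_inner_left(2)[of "u - r"] std_inner_left(3) by (cases "q = 0") simp_all
  have B: "u - s \<in> orth_compl B"
    unfolding us using p(2) r(2) unfolding q_def[symmetric]
    by (blast intro: vec.subspace_diff vec.subspace_scale subspace_orth_compl)
  then have "u - s \<in> orth_compl (vec.span B)" by (simp add: orth_compl_span)
  then have "std_inner p (u - s) = 0"
    using p(1) by (subst std_inner_eq_0_commute) (simp add: orth_compl_def)
  moreover have "std_inner q (u - s) = 0"
    using q by (simp only: std_inner_eq_0_commute)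
  ultimately have "std_inner (p + q) (u - s) = 0"
    by (simp only: std_inner_left add_0_left)
  then have "std_inner b (u - s) = 0" by (simp add: q_def)
  then have "std_inner (u - s) b = 0" by (simp only: std_inner_eq_0_commute)
  then have "u - s \<in> orth_compl (insert b B)"
    using B by (simp add: orth_compl_def)
  moreover have "p \<in> vec.span (insert b B)" "r \<in> vec.span (insert b B)" "b \<in> vec.span (insert b B)"
    using p(1) r(1) vec.span_mono[of B "insert b B"] by (auto intro: vec.span_base)
  then have "s \<in> vec.span (insert b B)"
    unfolding s_def q_def by (intro vec.span_add vec.span_scale vec.span_diff)
  ultimately show ?case by blast
qed

lemma orth_decomposition:
  fixes u :: "'a::conjugatable_ordered_field ^ 'n"
  assumes F: "vec.subspace F"
  obtains p where "p \<in> F" "u - p \<in> orth_compl F"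
proof -
  obtain B where B: "finite B" "vec.span B = F"
    using vec.basis_exists[of F] vec.finiteI_independent
    by (metis F vec.span_subspace)
  then show thesis using orth_decomposition_span[OF B(1), of u] that orth_compl_span[of B] by auto
qed

lemma orth_compl_Int:
  fixes F :: "('a::conjugatable_ordered_field ^ 'n) set"
  shows "u \<in> F \<Longrightarrow> u \<in> orth_compl F \<Longrightarrow> u = 0"
  by (auto simp: orth_compl_def)

lemma orth_proj_unique:
  fixes F :: "('a::conjugatable_ordered_field ^ 'n) set"
  assumes F: "vec.subspace F" and p: "p \<in> F" "u - p \<in> orth_compl F"
  shows "orth_proj F u = p"
  unfolding orth_proj_def
proof (rule the_equality)
  fix q assume q: "q \<in> F \<and> u - q \<in> orth_compl F"
  with p have "q - p \<in> F" "(u - p) - (u - q) \<in> orth_compl F"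
    by (blast intro: vec.subspace_diff F subspace_orth_compl)+
  then show "q = p" using orth_compl_Int[of "q - p"] by simp
qed (use p in blast)

lemma orth_proj:
  fixes F :: "('a::conjugatable_ordered_field ^ 'n) set"
  assumes "vec.subspace F"
  shows "orth_proj F u \<in> F" "u - orth_proj F u \<in> orth_compl F"
  using orth_decomposition[OF assms, of u] orth_proj_unique[OF assms] by metis+

lemma orth_proj_linear:
  fixes F :: "('a::conjugatable_ordered_field ^ 'n) set"
  assumes F: "vec.subspace F"
  shows "Vector_Spaces.linear (*s) (*s) (orth_proj F)"
proof -
  have "orth_proj F (u + v) = orth_proj F u + orth_proj F v" for u v
  proof (rule orth_proj_unique[OF F])
    have "(u - orth_proj F u) + (v - orth_proj F v) \<in> orth_compl F"
      by (intro vec.subspace_add subspace_orth_compl orth_proj F)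
    then show "u + v - (orth_proj F u + orth_proj F v) \<in> orth_compl F"
      by (simp add: algebra_simps)
  qed (intro vec.subspace_add orth_proj F)
  moreover have "orth_proj F (c *s u) = c *s orth_proj F u" for c u
  proof (rule orth_proj_unique[OF F])
    have "c *s (u - orth_proj F u) \<in> orth_compl F"
      by (intro vec.subspace_scale subspace_orth_compl orth_proj F)
    then show "c *s u - c *s orth_proj F u \<in> orth_compl F"
      by (simp add: vec.scale_right_diff_distrib)
  qed (intro vec.subspace_scale orth_proj F)
  ultimately show ?thesis
    by (simp add: Vector_Spaces.linear_iff vec.vector_space_axioms)
qed

lemma orth_proj_eq_0_iff:
  fixes F :: "('a::conjugatable_ordered_field ^ 'n) set"
  assumes F: "vec.subspace F"
  shows "orth_proj F u = 0 \<longleftrightarrow> u \<in> orth_compl F"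
  using orth_proj(2)[OF F, of u] orth_proj_unique[OF F, of 0 u] vec.subspace_0[OF F] by auto

text \<open>For \<open>u\<close> in the double complement, \<open>u - orth_proj F u\<close> lies
  both in \<open>orth_compl F\<close> and in its complement, hence is zero.\<close>

lemma orth_compl_orth_compl:
  fixes F :: "('a::conjugatable_ordered_field ^ 'n) set"
  assumes F: "vec.subspace F"
  shows "orth_compl (orth_compl F) = F"
proof
  show "F \<subseteq> orth_compl (orth_compl F)"
    by (auto simp: orth_compl_def std_inner_eq_0_commute)
  then have "u - orth_proj F u \<in> orth_compl (orth_compl F)" if "u \<in> orth_compl (orth_compl F)" for u
    using that orth_proj(1)[OF F, of u] by (intro vec.subspace_diff subspace_orth_compl) auto
  then have "u = orth_proj F u" if "u \<in> orth_compl (orth_compl F)" for u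
    using that orth_compl_Int[OF orth_proj(2)[OF F, of u]] by simp
  then show "orth_compl (orth_compl F) \<subseteq> F"
    using orth_proj(1)[OF F] by (metis subsetI)
qed

lemma orth_compl_antimono: "S \<subseteq> T \<Longrightarrow> orth_compl T \<subseteq> orth_compl S"
  by (auto simp: orth_compl_def)

lemma dim_orth_compl:
  fixes F :: "('a::conjugatable_ordered_field ^ 'n) set"
  assumes F: "vec.subspace F"
  shows "vec.dim F + vec.dim (orth_compl F) = CARD('n)"
proof -
  have "{x + y |x y. x \<in> F \<and> y \<in> orth_compl F} = UNIV"
  proof -
    have "u = orth_proj F u + (u - orth_proj F u)" for u by simp
    then show ?thesis using orth_proj[OF F] by blast
  qed
  moreover have "vec.dim (F \<inter> orth_compl F) = 0"
    using orth_compl_Int by (auto simp: vec.dim_eq_0)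
  ultimately show ?thesis
    using vec.dim_sums_Int[OF F subspace_orth_compl[of F]]
    by (simp only: add_0_right vec.dim_UNIV vec_dim_card vec.dimension_def dimension_def card_cart_basis)
qed

text \<open>Because \<open>E'\<close> contains the complement of \<open>F'\<close>, the sum of
  \<open>E'\<close> and \<open>F'\<close> is the whole space. The size thus becomes a difference of
  two dimensions that can be compared with ranks.\<close>

lemma separator_size:
  fixes E' F' :: "('a::conjugatable_ordered_field ^ 'n) set"
  assumes E': "vec.subspace E'" and F': "vec.subspace F'" and sub: "orth_compl F' \<subseteq> E'"
  shows "vec.dim (E' \<inter> F') + vec.dim (orth_compl F') = vec.dim E'"
proof -
  have "x \<in> {x + y |x y. x \<in> E' \<and> y \<in> F'}" for x
  proof -
    have "x = (x - orth_proj F' x) + orth_proj F' x" by simp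
    then show ?thesis using orth_proj[OF F', of x] sub by blast
  qed
  then have "{x + y |x y. x \<in> E' \<and> y \<in> F'} = UNIV" by blast
  then show ?thesis
    using vec.dim_sums_Int[OF E' F'] dim_orth_compl[OF F']
    by (simp only: vec_dim_card)
qed

section \<open>The block map and the rank bound given by a separator\<close>

interpretation pair_pair: finite_dimensional_vector_space_pair
  pair.scale pair.Basis_pair pair.scale pair.Basis_pair ..

interpretation pair_vec: finite_dimensional_vector_space_pair
  pair.scale pair.Basis_pair "(*s)" cart_basis ..

lemma block_map_linear:
  fixes F :: "('a::conjugatable_ordered_field ^ 'n) set"
  assumes F: "vec.subspace F"
  shows "Vector_Spaces.linear pair.scale pair.scale (block_map F A)"
proof -
  interpret P: Vector_Spaces.linear "(*s)" "(*s)" "orth_proj F"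
    by (rule orth_proj_linear[OF F])
  show ?thesis
    by (auto simp: Vector_Spaces.linear_iff pair.p.vector_space_axioms block_map_def pair.scale_def
        P.add P.scale vec.add vec.scale vec.scale_right_distrib algebra_simps)
qed

text \<open>Membership of \<open>M *v u\<close> in \<open>X\<close> is a linear condition on
  \<open>M\<close>, so it suffices to check the generators \<open>outer w v\<close>, which send
  \<open>u\<close> to a multiple of \<open>w\<close>.\<close>

lemma rel_space_mult_mem:
  fixes A :: "'a::conjugatable_field ^ 'n ^ 'n"
  assumes A: "A \<in> rel_space R" and X: "vec.subspace X"
    and R: "\<And>v w. (v, w) \<in> R \<Longrightarrow> std_inner u v = 0 \<or> w \<in> X"
  shows "A *v u \<in> X"
proof -
  have scale: "mat_scale c M *v u = c *s (M *v u)" for c and M :: "'a ^ 'n ^ 'n"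
    by (simp add: mat_scale_def matrix_vector_mult_def vec_eq_iff sum_distrib_left mult.assoc)
  have "mat.subspace {M. M *v u \<in> X}"
    using X by (auto simp: mat.subspace_def vec.subspace_def matrix_vector_mult_add_rdistrib scale)
  moreover have "outer w v *v u \<in> X" if "(v, w) \<in> R" for v w
    using R[OF that] X by (auto simp: outer_mult_vec vec.subspace_scale vec.subspace_0)
  ultimately have "rel_space R \<subseteq> {M. M *v u \<in> X}"
    unfolding rel_space_def by (intro mat.span_minimal) auto
  then show ?thesis using A by blast
qed

text \<open>Enlarging the domain from \<open>?S\<close> to \<open>?D\<close> adds
  \<open>n - dim ?N\<close> dimensions and cannot shrink the kernel, so the rank grows by at most
  that amount. On \<open>?S\<close> the rank is at most the dimension of \<open>E'\<close>.\<close>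

lemma block_rank_le_separator:
  fixes E F :: "('a::conjugatable_ordered_field ^ 'n) set"
  assumes E: "vec.subspace E" and F: "vec.subspace F"
    and sep: "is_separator R E F E' F'" and A: "A \<in> rel_space R"
  shows "block_rank E F A \<le> vec.dim (E' \<inter> F') + CARD('n)"
proof -
  have E': "vec.subspace E'" and F': "vec.subspace F'" and sub: "E \<subseteq> E'" "F \<subseteq> F'"
    and N: "orth_compl F' \<subseteq> E'" and R: "\<And>v w. (v, w) \<in> R \<Longrightarrow> v \<in> F' \<or> w \<in> E'"
    using sep by (auto simp: is_separator_def)
  let ?f = "block_map F A" and ?N = "orth_compl F'"
  let ?D = "(UNIV :: ('a ^ 'n) set) \<times> E" and ?S = "?N \<times> E"
  note f = block_map_linear[OF F, of A]
  have D: "pair.p.subspace ?D" and S: "pair.p.subspace ?S"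
    by (intro pair.subspace_Times vec.subspace_UNIV subspace_orth_compl E)+
  have "?f ` ?S \<subseteq> E' \<times> {0}"
  proof (rule image_subsetI)
    fix x assume "x \<in> ?S"
    then obtain u e where x: "x = (u, e)" and u: "u \<in> ?N" and e: "e \<in> E" by blast
    have "A *v u \<in> E'"
      using u R by (intro rel_space_mult_mem[OF A E']) (force simp: orth_compl_def)
    then have "(mat 1 - A) *v u + e \<in> E'"
      using u e N sub(1) E'
      by (auto simp: matrix_vector_mult_diff_rdistrib intro!: vec.subspace_add vec.subspace_diff)
    moreover have "orth_proj F u = 0"
      using u orth_compl_antimono[OF sub(2)] by (auto simp: orth_proj_eq_0_iff[OF F])
    ultimately show "?f x \<in> E' \<times> {0}" by (simp add: x block_map_def)
  qed
  then have "pair.p.dim (?f ` ?S) \<le> pair.p.dim (E' \<times> {0 :: 'a ^ 'n})"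
    by (rule pair.p.dim_subset)
  then have "pair.p.dim (?f ` ?S) \<le> vec.dim E'"
    using pair.dim_Times[OF E' vec.subspace_single_0] by simp
  moreover have "pair.p.dim {x \<in> ?S. ?f x = 0} \<le> pair.p.dim {x \<in> ?D. ?f x = 0}"
    by (intro pair.p.dim_subset) auto
  ultimately have "block_rank E F A + vec.dim ?N \<le> vec.dim E' + CARD('n)"
    using pair_pair.dim_image_kernel[OF f D] pair_pair.dim_image_kernel[OF f S]
      pair.dim_Times[OF vec.subspace_UNIV E] pair.dim_Times[OF subspace_orth_compl[of F'] E]
    unfolding block_rank_def vec_dim_card by linarith
  then show ?thesis
    using separator_size[OF E' F' N] by linarith
qed

section \<open>Construction of a separator from a block map of maximal rank\<close>

lemma max_block_rank_separator:
  fixes E F :: "('a::conjugatable_ordered_field ^ 'n) set"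
  assumes E: "vec.subspace E" and F: "vec.subspace F" and A: "A \<in> rel_space R"
    and max: "\<And>B. B \<in> rel_space R \<Longrightarrow> block_rank E F B \<le> block_rank E F A"
  obtains E' F' where "is_separator R E F E' F'"
    "vec.dim (E' \<inter> F') + CARD('n) \<le> block_rank E F A"
proof -
  let ?D = "(UNIV :: ('a ^ 'n) set) \<times> E"
  define f where "f = block_map F A"
  interpret f: Vector_Spaces.linear pair.scale pair.scale f
    unfolding f_def by (rule block_map_linear[OF F])
  note lin_f = f.linear_axioms
  \<comment> \<open>The sign is that of \<open>A\<close> in \<open>I - A\<close>.\<close>
  define G where "G = {(\<lambda>x :: ('a ^ 'n) \<times> ('a ^ 'n). std_inner (fst x) v, (- w, 0 :: 'a ^ 'n))
    |v w. (v, w) \<in> R}"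
  have D: "pair.p.subspace ?D" by (intro pair.subspace_Times vec.subspace_UNIV E)
  obtain K where K: "pair.p.subspace K" "K \<subseteq> ?D" "{x \<in> ?D. f x = 0} \<subseteq> K"
    and "\<And>\<phi> w. (\<phi>, w) \<in> G \<Longrightarrow> (\<forall>x\<in>K. \<phi> x = 0) \<or> w \<in> f ` K"
  proof (rule pair_pair.max_rank_obstruction[of "block_map F ` rel_space R" G ?D f])
    fix g assume "g \<in> block_map F ` rel_space R"
    then show "Vector_Spaces.linear pair.scale pair.scale g"
      using block_map_linear[OF F] by blast
  next
    fix \<phi> w assume "(\<phi>, w) \<in> G"
    then show "Vector_Spaces.linear pair.scale (*) \<phi>"
      by (auto simp: G_def Vector_Spaces.linear_iff pair.p.vector_space_axioms
          vector_space_over_itself.vector_space_axioms pair.scale_def)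
  next
    fix g \<phi> w' assume "g \<in> block_map F ` rel_space R" "(\<phi>, w') \<in> G"
    then obtain B v w where B: "B \<in> rel_space R" "g = block_map F B" and R: "(v, w) \<in> R"
      and \<phi>: "\<phi> = (\<lambda>x. std_inner (fst x) v)" "w' = (- w, 0)"
      by (auto simp: G_def)
    have "B + outer w v \<in> rel_space R"
      using B(1) R unfolding rel_space_def by (blast intro: mat.span_add mat.span_base)
    moreover have "(\<lambda>x. g x + pair.scale (\<phi> x) w') = block_map F (B + outer w v)"
      by (auto simp: fun_eq_iff B \<phi> block_map_def pair.scale_def outer_mult_vec
          matrix_vector_mult_diff_rdistrib matrix_vector_mult_add_rdistrib)
    ultimately show "(\<lambda>x. g x + pair.scale (\<phi> x) w') \<in> block_map F ` rel_space R" by simp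
  next
    fix g assume "g \<in> block_map F ` rel_space R"
    then show "pair.p.dim (g ` ?D) \<le> pair.p.dim (f ` ?D)"
      using max by (auto simp: block_rank_def f_def)
  qed (use D A f_def in auto)
  then have alt: "(\<forall>x\<in>K. std_inner (fst x) v = 0) \<or> (w, 0) \<in> f ` K" if "(v, w) \<in> R" for v w
  proof -
    have "(\<lambda>x. std_inner (fst x) v, (- w, 0)) \<in> G" using that by (auto simp: G_def)
    then have "(\<forall>x\<in>K. std_inner (fst x) v = 0) \<or> (- w, 0) \<in> f ` K"
      by fact
    moreover have "(w, 0) \<in> f ` K" if "(- w, 0) \<in> f ` K"
      using pair.p.subspace_neg[OF f.subspace_image[OF K(1)] that] by simp
    ultimately show ?thesis by blast
  qed

  define W where "W = {w. (w, 0) \<in> f ` K}"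
  define N where "N = {u \<in> fst ` K. orth_proj F u = 0}"
  define E' where "E' = {x + y |x y. x \<in> W \<and> y \<in> E}"
  define F' where "F' = orth_compl N"
  have fK: "pair.p.subspace (f ` K)" using K(1) by (rule f.subspace_image)
  have fstK: "vec.subspace (fst ` K)"
    by (rule pair_vec.linear_subspace_image[OF pair.linear_fst K(1)])
  interpret P: Vector_Spaces.linear "(*s)" "(*s)" "orth_proj F"
    by (rule orth_proj_linear[OF F])
  have W: "vec.subspace W"
    unfolding vec.subspace_def
  proof (intro conjI ballI allI)
    show "0 \<in> W" using pair.p.subspace_0[OF fK] by (simp add: W_def zero_prod_def)
    show "x + y \<in> W" if "x \<in> W" "y \<in> W" for x y
      using pair.p.subspace_add[OF fK, of "(x, 0)" "(y, 0)"] that by (simp add: W_def)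
    show "c *s x \<in> W" if "x \<in> W" for c x
      using pair.p.subspace_scale[OF fK, of "(x, 0)" c] that by (simp add: W_def pair.scale_def)
  qed
  have N: "vec.subspace N"
    using vec.subspace_inter[OF fstK P.subspace_kernel] by (simp add: N_def Int_def)
  have E': "vec.subspace E'"
    unfolding E'_def using W E by (rule vec.subspace_sums)
  have F': "vec.subspace F'"
    unfolding F'_def by (rule subspace_orth_compl)
  have orth_F': "orth_compl F' = N"
    unfolding F'_def by (rule orth_compl_orth_compl[OF N])
  have "W \<subseteq> E'" "E \<subseteq> E'"
    using vec.subspace_0[OF W] vec.subspace_0[OF E] by (force simp: E'_def)+
  \<comment> \<open>For \<open>(u, e)\<close> in \<open>K\<close> with \<open>u\<close> in
    \<open>N\<close>, the map \<open>f\<close> gives \<open>(u - A *v u + e, 0)\<close>. Its first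
    entry is in \<open>W\<close>, and so is \<open>A *v u\<close> by \<open>alt\<close>; hence
    \<open>u + e\<close> is in \<open>W\<close>.\<close>
  have "N \<subseteq> E'"
  proof
    fix u assume "u \<in> N"
    then obtain e where u: "(u, e) \<in> K" "orth_proj F u = 0" by (auto simp: N_def)
    then have e: "e \<in> E" using K(2) by auto
    have "A *v u \<in> W"
      using alt u(1) by (intro rel_space_mult_mem[OF A W]) (force simp: W_def)
    moreover have "u - A *v u + e \<in> W"
      using imageI[OF u(1), of f] u(2)
      by (simp add: W_def f_def block_map_def matrix_vector_mult_diff_rdistrib)
    ultimately have "(u - A *v u + e) + A *v u \<in> W" by (blast intro: vec.subspace_add[OF W])
    then have "u + e \<in> W" by (simp add: algebra_simps)
    then have "(u + e) - e \<in> E'"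
      using \<open>W \<subseteq> E'\<close> \<open>E \<subseteq> E'\<close> e by (intro vec.subspace_diff[OF E']) auto
    then show "u \<in> E'" by simp
  qed
  have "is_separator R E F E' F'"
    unfolding is_separator_def orth_F'
  proof (intro conjI E' F' \<open>E \<subseteq> E'\<close> \<open>N \<subseteq> E'\<close>)
    have "N \<subseteq> orth_compl F" by (auto simp: N_def orth_proj_eq_0_iff[OF F])
    then show "F \<subseteq> F'"
      unfolding F'_def using orth_compl_antimono orth_compl_orth_compl[OF F] by metis
    have "v \<in> F' \<or> w \<in> E'" if "(v, w) \<in> R" for v w
      using alt[OF that] \<open>W \<subseteq> E'\<close>
      by (auto simp: F'_def orth_compl_def N_def W_def std_inner_eq_0_commute[of v])
    then show "\<forall>(v, w)\<in>R. v \<in> F' \<or> w \<in> E'" by blast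
  qed
  \<comment> \<open>The count consists of equalities, except that the vectors \<open>(0, e)\<close>
    in \<open>K\<close> may span less than \<open>W \<inter> E\<close>. They bound the size by
    \<open>dim E - dim K\<close> plus the rank of \<open>f\<close> on \<open>K\<close>, which is the
    rank on \<open>?D\<close> minus \<open>n\<close>.\<close>
  moreover have "vec.dim (E' \<inter> F') + CARD('n) \<le> block_rank E F A"
  proof -
    have "vec.dim E' + vec.dim (W \<inter> E) = vec.dim W + vec.dim E"
      unfolding E'_def by (rule vec.dim_sums_Int[OF W E])
    moreover have "vec.dim (E' \<inter> F') + vec.dim N = vec.dim E'"
      using separator_size[OF E' F'] \<open>N \<subseteq> E'\<close> by (simp add: orth_F')
    moreover have "vec.dim N + vec.dim (orth_proj F ` fst ` K) = vec.dim (fst ` K)"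
      unfolding N_def by (rule vec.dim_image_kernel[OF P.linear_axioms fstK])
    moreover have "pair.p.dim {x \<in> K. fst x = 0} + vec.dim (fst ` K) = pair.p.dim K"
      by (rule pair_vec.dim_image_kernel[OF pair.linear_fst K(1)])
    moreover have "pair.p.dim {x \<in> K. fst x = 0} \<le> vec.dim (W \<inter> E)"
    proof -
      have "e \<in> W \<inter> E" if "(0, e) \<in> K" for e
        using imageI[OF that, of f] K(2) that by (auto simp: W_def f_def block_map_def P.zero)
      then have "{x \<in> K. fst x = 0} \<subseteq> {0} \<times> (W \<inter> E)" by auto
      then have "pair.p.dim {x \<in> K. fst x = 0} \<le> pair.p.dim ({0} \<times> (W \<inter> E))"
        by (rule pair.p.dim_subset)
      also have "\<dots> = vec.dim (W \<inter> E)"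
        using pair.dim_Times[OF vec.subspace_single_0 vec.subspace_inter[OF W E]] by simp
      finally show ?thesis .
    qed
    \<comment> \<open>Rank-nullity for the second projection on the image of \<open>K\<close>: its
      kernel there is \<open>W \<times> {0}\<close>.\<close>
    moreover have "vec.dim W + vec.dim (orth_proj F ` fst ` K) = pair.p.dim (f ` K)"
    proof -
      have "x \<in> {x \<in> f ` K. snd x = 0} \<longleftrightarrow> x \<in> W \<times> {0}" for x
        by (cases x; cases "snd x = 0") (simp_all add: W_def)
      then have "{x \<in> f ` K. snd x = 0} = W \<times> {0}" by blast
      moreover have "snd ` f ` K = orth_proj F ` fst ` K"
        by (force simp: f_def block_map_def image_image)
      ultimately show ?thesis
        using pair_vec.dim_image_kernel[OF pair.linear_snd fK]
          pair.dim_Times[OF W vec.subspace_single_0] by simp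
    qed
    \<comment> \<open>The kernel of \<open>f\<close> on \<open>?D\<close> lies inside
      \<open>K\<close>, so it cancels between the two rank-nullity formulas.\<close>
    moreover have "pair.p.dim {x \<in> K. f x = 0} = pair.p.dim {x \<in> ?D. f x = 0}"
      using K by (intro arg_cong[of _ _ pair.p.dim]) blast
    then have "pair.p.dim (f ` ?D) + pair.p.dim K = CARD('n) + vec.dim E + pair.p.dim (f ` K)"
      using pair_pair.dim_image_kernel[OF lin_f K(1)] pair_pair.dim_image_kernel[OF lin_f D]
        pair.dim_Times[OF vec.subspace_UNIV E] unfolding vec_dim_card by linarith
    ultimately show ?thesis
      unfolding block_rank_def f_def[symmetric] by linarith
  qed
  ultimately show thesis by (rule that)
qed

text \<open>One matrix attaining the maximum serves both directions: the separator built from it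
  bounds the minimum above, and a minimal separator bounds its rank. The ordered field class treats
  the real and complex cases together.\<close>

lemma coherent_path_capacity_eq_min_separator_size:
  fixes E F :: "('a::conjugatable_ordered_field ^ 'n) set"
  assumes E: "vec.subspace E" and F: "vec.subspace F"
  shows "coherent_path_capacity R E F = int (min_separator_size R E F)"
proof -
  let ?S = "{int (block_rank E F A) - int CARD('n) |A. A \<in> rel_space R}"
  let ?T = "{vec.dim (E' \<inter> F') |E' F'. is_separator R E F E' F'}"
  note S = capacity_set_finite_nonempty[of E F R]
  note T = separator_set_finite_nonempty[of R E F]
  have "Max ?S \<in> ?S" using S by (rule Max_in)
  then obtain A where A: "A \<in> rel_space R" "Max ?S = int (block_rank E F A) - int CARD('n)"
    by blast
  have "block_rank E F B \<le> block_rank E F A" if "B \<in> rel_space R" for B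
  proof -
    have "int (block_rank E F B) - int CARD('n) \<le> Max ?S" using that S by (intro Max_ge) auto
    then show ?thesis using A(2) by linarith
  qed
  then obtain E' F' where sep: "is_separator R E F E' F'"
    and le: "vec.dim (E' \<inter> F') + CARD('n) \<le> block_rank E F A"
    using max_block_rank_separator[OF E F A(1)] by metis
  have "Min ?T \<le> vec.dim (E' \<inter> F')" using T sep by (intro Min_le) auto
  moreover obtain E'' F'' where "is_separator R E F E'' F''" "Min ?T = vec.dim (E'' \<inter> F'')"
    using Min_in[OF T] by blast
  then have "block_rank E F A \<le> Min ?T + CARD('n)"
    using block_rank_le_separator[OF E F _ A(1)] by metis
  ultimately show ?thesis
    unfolding coherent_path_capacity_def min_separator_size_def A(2) using le by linarith
qed

theorem theorem1p21:
  shows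
    "(\<forall>(R :: ((real ^ 'n) \<times> (real ^ 'n)) set) E F.
        vec.subspace E \<longrightarrow> vec.subspace F \<longrightarrow>
        coherent_path_capacity R E F = int (min_separator_size R E F)) \<and>
     (\<forall>(R :: ((complex ^ 'n) \<times> (complex ^ 'n)) set) E F.
        vec.subspace E \<longrightarrow> vec.subspace F \<longrightarrow>
        coherent_path_capacity R E F = int (min_separator_size R E F))"
  by (intro conjI allI impI coherent_path_capacity_eq_min_separator_size)

end
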